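(* Let $T$ be a Krull monoid, $H\subseteq T$ a saturated submonoid, $I$ a nonempty divisorial ideal of $H$, and $P\in\mathfrak{X}(H)$. Then $$\mathrm{v}_P(I)=\max\Big\{\Big\lceil\frac{\mathrm{v}_Q(I_{v_T})}{\mathrm{v}_Q(P_{v_T})}\Big\rceil\;\Big|\;Q\in\mathfrak{X}(T),\ Q\cap H=P\Big\}.$$
   Context: Monoids are commutative and cancellative with identity. A submonoid $H\subseteq T$ is saturated if for all $x,y\in H$ such that $x$ divides $y$ in $T$, $x$ divides $y$ in $H$. For a monoid $H$ with quotient group $L$: an $s$-ideal is a subset $I\subseteq H$ with $IH=I$ (the empty set is allowed); it is prime if $I\neq H$ and $H\setminus I$ is a submonoid. $\mathfrak{X}(H)$ is the set of minimal nonempty prime $s$-ideals of $H$. For $Y\subseteq L$ put $Y^{-1}=\{z\in L\mid zY\subseteq H\}$ and $Y_{v_H}=(Y^{-1})^{-1}$; $I\subseteq H$ is divisorial (a $v$-ideal) if $I_{v_H}=I$. The subscript $v_T$ denotes the same operation formed with respect to the monoid $T$ and its quotient group. $H$ is a Krull monoid if it is a completely integrally closed Mori monoid, equivalently every nonempty $v$-ideal of $H$ is a finite $v$-product of height-one prime ideals; then every nonempty divisorial ideal $I$ of $H$ is uniquely of the form $(\prod_{P\in\mathfrak{X}(H)}P^{\mathrm{v}_P(I)})_{v_H}$ with $\mathrm{v}_P(I)\in\mathbb{N}_0$, almost all zero. A saturated submonoid of a Krull monoid is a Krull monoid. *)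

theory Defs
  imports Complex_Main "HOL-Algebra.Algebra"
begin

text \<open>
  A commutative cancellative monoid is represented as a submonoid \<open>H\<close> of a commutative group \<open>G\<close>.
  No generality is lost, as every such monoid lies in its quotient group; conversely the
  quotient group of a submonoid \<open>H\<close> of \<open>G\<close> is realised inside \<open>G\<close> as the set of fractions of
  elements of \<open>H\<close>. The ambient group \<open>G\<close> may be larger than this set.
\<close>

definition quotient_group :: "('a, 'b) monoid_scheme \<Rightarrow> 'a set \<Rightarrow> 'a set" where
  "quotient_group G H = {x \<otimes>\<^bsub>G\<^esub> inv\<^bsub>G\<^esub> y | x y. x \<in> H \<and> y \<in> H}"

definition saturated_submonoid :: "('a, 'b) monoid_scheme \<Rightarrow> 'a set \<Rightarrow> 'a set \<Rightarrow> bool" where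
  "saturated_submonoid G T H \<longleftrightarrow> submonoid H G \<and> H \<subseteq> T \<and>
     (\<forall>x\<in>H. \<forall>y\<in>H. x divides\<^bsub>G\<lparr>carrier := T\<rparr>\<^esub> y \<longrightarrow> x divides\<^bsub>G\<lparr>carrier := H\<rparr>\<^esub> y)"

definition s_ideal :: "('a, 'b) monoid_scheme \<Rightarrow> 'a set \<Rightarrow> 'a set \<Rightarrow> bool" where
  "s_ideal G H I \<longleftrightarrow> I \<subseteq> H \<and> I <#>\<^bsub>G\<^esub> H = I"

definition prime_s_ideal :: "('a, 'b) monoid_scheme \<Rightarrow> 'a set \<Rightarrow> 'a set \<Rightarrow> bool" where
  "prime_s_ideal G H P \<longleftrightarrow> s_ideal G H P \<and> P \<noteq> H \<and> submonoid (H - P) G"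

definition height_one_primes :: "('a, 'b) monoid_scheme \<Rightarrow> 'a set \<Rightarrow> 'a set set" where
  "height_one_primes G H =
     {P. prime_s_ideal G H P \<and> P \<noteq> {} \<and>
         (\<forall>Q. prime_s_ideal G H Q \<and> Q \<noteq> {} \<and> Q \<subseteq> P \<longrightarrow> Q = P)}"

definition v_inverse :: "('a, 'b) monoid_scheme \<Rightarrow> 'a set \<Rightarrow> 'a set \<Rightarrow> 'a set" where
  "v_inverse G H Y = {z \<in> quotient_group G H. z <#\<^bsub>G\<^esub> Y \<subseteq> H}"

definition v_closure :: "('a, 'b) monoid_scheme \<Rightarrow> 'a set \<Rightarrow> 'a set \<Rightarrow> 'a set" where
  "v_closure G H Y = v_inverse G H (v_inverse G H Y)"

definition divisorial_ideal :: "('a, 'b) monoid_scheme \<Rightarrow> 'a set \<Rightarrow> 'a set \<Rightarrow> bool" where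
  "divisorial_ideal G H I \<longleftrightarrow> I \<subseteq> H \<and> v_closure G H I = I"

definition completely_integrally_closed :: "('a, 'b) monoid_scheme \<Rightarrow> 'a set \<Rightarrow> bool" where
  "completely_integrally_closed G H \<longleftrightarrow>
     (\<forall>x\<in>quotient_group G H. (\<exists>c\<in>H. \<forall>n::nat. c \<otimes>\<^bsub>G\<^esub> (x [^]\<^bsub>G\<^esub> n) \<in> H) \<longrightarrow> x \<in> H)"

definition mori_monoid :: "('a, 'b) monoid_scheme \<Rightarrow> 'a set \<Rightarrow> bool" where
  "mori_monoid G H \<longleftrightarrow> submonoid H G \<and>
     (\<forall>I :: nat \<Rightarrow> 'a set. (\<forall>n. divisorial_ideal G H (I n)) \<and> (\<forall>n. I n \<subseteq> I (Suc n)) \<longrightarrow>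
        (\<exists>N. \<forall>n\<ge>N. I n = I N))"

definition krull_monoid :: "('a, 'b) monoid_scheme \<Rightarrow> 'a set \<Rightarrow> bool" where
  "krull_monoid G H \<longleftrightarrow> mori_monoid G H \<and> completely_integrally_closed G H"

text \<open>
  The monoid of \<open>s\<close>-ideals under elementwise multiplication. Its identity is \<open>H\<close>, so \<open>P [^] 0 = H\<close>.
\<close>

definition s_ideal_monoid :: "('a, 'b) monoid_scheme \<Rightarrow> 'a set \<Rightarrow> 'a set monoid" where
  "s_ideal_monoid G H = \<lparr>carrier = {I. s_ideal G H I}, monoid.mult = (<#>\<^bsub>G\<^esub>), one = H\<rparr>"

text \<open>
  \<open>e\<close> is a family of exponents of a factorization of \<open>I\<close> as a \<open>v\<close>-product of height-one primes.
  The product runs over the (finite) support of \<open>e\<close> only, since \<open>finprod\<close> over an infinite index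
  set is the identity by convention. Outside \<open>height_one_primes G H\<close> the total function \<open>e\<close> is
  required to vanish, so that uniqueness of the exponents is equality of functions.
\<close>

definition v_factorization ::
  "('a, 'b) monoid_scheme \<Rightarrow> 'a set \<Rightarrow> 'a set \<Rightarrow> ('a set \<Rightarrow> nat) \<Rightarrow> bool" where
  "v_factorization G H I e \<longleftrightarrow>
     finite {P. e P \<noteq> 0} \<and> {P. e P \<noteq> 0} \<subseteq> height_one_primes G H \<and>
     I = v_closure G H
           (\<Otimes>\<^bsub>s_ideal_monoid G H\<^esub>P\<in>{P. e P \<noteq> 0}. P [^]\<^bsub>s_ideal_monoid G H\<^esub> e P)"

text \<open>\<open>v_val G H P I\<close> is the exponent \<open>v\<^sub>P(I)\<close>; it is meaningful for a Krull monoid \<open>H\<close>, a nonempty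
  divisorial ideal \<open>I\<close> and a height-one prime \<open>P\<close>.\<close>

definition v_val :: "('a, 'b) monoid_scheme \<Rightarrow> 'a set \<Rightarrow> 'a set \<Rightarrow> 'a set \<Rightarrow> nat" where
  "v_val G H P I = (THE e. v_factorization G H I e) P"

end

theory Submission
  imports Defs
begin

text \<open>
  In a Krull monoid \<open>H\<close> the height-one primes are the maximal proper divisorial ideals. For such a
  \<open>P\<close>, complete integral closedness yields \<open>p \<in> P\<close> and \<open>z \<in> P\<inverse>\<close> with \<open>zp \<notin> P\<close>, and every
  \<open>x \<in> H\<close> has a unique \<open>n\<close> with \<open>z\<^sup>n x \<in> H - P\<close>; this \<open>n\<close> is the discrete valuation of \<open>x\<close> at \<open>P\<close>,
  and the exponent of \<open>P\<close> in a divisorial ideal is its minimum over the ideal.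

  If \<open>H\<close> is saturated in \<open>T\<close> and \<open>Q\<close> lies over \<open>P\<close>, then \<open>zp\<close> and \<open>z\<^sup>n x\<close> are outside \<open>Q\<close>, so the identity
  \<open>p\<^sup>n (z\<^sup>n x) = (zp)\<^sup>n x\<close> shows that the \<open>Q\<close>-valuation on \<open>H\<close> is a constant multiple of the
  \<open>P\<close>-valuation. Thus every quotient in the maximum already equals the exponent of \<open>P\<close> in \<open>I\<close>. Some
  \<open>Q\<close> does lie over \<open>P\<close>: for \<open>a \<in> P\<close>, a product of primes of \<open>T\<close> containing \<open>a\<close> lies in \<open>aT\<close>, and
  \<open>aT \<inter> H = aH \<subseteq> P\<close>, so one of these primes misses \<open>H - P\<close>.
\<close>

section \<open>Fractional ideals of a submonoid of a commutative group\<close>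

locale comm_group_submonoid = comm_group G + submonoid H G for G (structure) and H

context comm_group_submonoid
begin

lemma quotient_group_carrier [simp]: "x \<in> quotient_group G H \<Longrightarrow> x \<in> carrier G"
  by (auto simp: quotient_group_def)

lemma quotient_group_mult [simp]:
  assumes "x \<in> quotient_group G H" "y \<in> quotient_group G H"
  shows "x \<otimes> y \<in> quotient_group G H"
proof -
  obtain a b c d where *: "x = a \<otimes> inv b" "y = c \<otimes> inv d" "a \<in> H" "b \<in> H" "c \<in> H" "d \<in> H"
    using assms by (auto simp: quotient_group_def)
  then have "x \<otimes> y = (a \<otimes> c) \<otimes> inv (b \<otimes> d)"
    by (simp add: inv_mult m_ac)
  with * show ?thesis unfolding quotient_group_def by blast
qed

lemma quotient_group_inv [simp]:
  assumes "x \<in> quotient_group G H"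
  shows "inv x \<in> quotient_group G H"
proof -
  obtain a b where *: "x = a \<otimes> inv b" "a \<in> H" "b \<in> H"
    using assms by (auto simp: quotient_group_def)
  then have "inv x = b \<otimes> inv a"
    by (simp add: inv_mult m_ac)
  with * show ?thesis unfolding quotient_group_def by blast
qed

lemma mem_quotient_group [simp]: "x \<in> H \<Longrightarrow> x \<in> quotient_group G H"
  unfolding quotient_group_def by (rule CollectI, rule exI[of _ x], rule exI[of _ \<one>]) simp

lemma quotient_group_pow [simp]:
  "x \<in> quotient_group G H \<Longrightarrow> x [^] (n::nat) \<in> quotient_group G H"
  by (induction n) auto

lemma pow_closed [simp]: "x \<in> H \<Longrightarrow> x [^] (n::nat) \<in> H"
  by (induction n) auto

lemma v_inverse_iff:
  "z \<in> v_inverse G H Y \<longleftrightarrow> z \<in> quotient_group G H \<and> (\<forall>y\<in>Y. z \<otimes> y \<in> H)"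
  by (auto simp: v_inverse_def l_coset_def)

lemma v_inverse_subset: "v_inverse G H Y \<subseteq> quotient_group G H"
  by (auto simp: v_inverse_iff)

lemma v_closure_subset_quotient: "v_closure G H Y \<subseteq> quotient_group G H"
  unfolding v_closure_def by (rule v_inverse_subset)

lemma v_closure_iff:
  "x \<in> v_closure G H Y \<longleftrightarrow> x \<in> quotient_group G H \<and> (\<forall>z\<in>v_inverse G H Y. x \<otimes> z \<in> H)"
  by (simp add: v_closure_def v_inverse_iff[of x])

lemma subset_v_closure:
  assumes "Y \<subseteq> quotient_group G H"
  shows "Y \<subseteq> v_closure G H Y"
proof
  fix y assume "y \<in> Y"
  then have "y \<otimes> z \<in> H" if "z \<in> v_inverse G H Y" for z
    using that assms by (auto simp: v_inverse_iff m_comm[of y z] subset_iff)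
  with \<open>y \<in> Y\<close> assms show "y \<in> v_closure G H Y" by (auto simp: v_closure_iff)
qed

lemma v_inverse_antimono: "A \<subseteq> B \<Longrightarrow> v_inverse G H B \<subseteq> v_inverse G H A"
  by (auto simp: v_inverse_iff subset_iff)

lemma v_closure_mono: "A \<subseteq> B \<Longrightarrow> v_closure G H A \<subseteq> v_closure G H B"
  by (simp add: v_closure_def v_inverse_antimono)

text \<open>\<open>v_inverse\<close> is an antitone Galois connection with itself, so a threefold
  inverse collapses to a single one.\<close>

lemma v_inverse_v_closure:
  assumes "Y \<subseteq> quotient_group G H"
  shows "v_inverse G H (v_closure G H Y) = v_inverse G H Y"
proof
  show "v_inverse G H (v_closure G H Y) \<subseteq> v_inverse G H Y"
    by (intro v_inverse_antimono subset_v_closure assms)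
  show "v_inverse G H Y \<subseteq> v_inverse G H (v_closure G H Y)"
    unfolding v_closure_def using v_inverse_subset subset_v_closure v_closure_def by metis
qed

lemma v_closure_idem:
  "Y \<subseteq> quotient_group G H \<Longrightarrow> v_closure G H (v_closure G H Y) = v_closure G H Y"
  by (metis v_closure_def v_inverse_v_closure)

lemma one_mem_v_inverse: "Y \<subseteq> H \<Longrightarrow> \<one> \<in> v_inverse G H Y"
  by (auto simp: v_inverse_iff subset_iff)

lemma v_closure_subset:
  assumes "Y \<subseteq> H"
  shows "v_closure G H Y \<subseteq> H"
proof
  fix x assume "x \<in> v_closure G H Y"
  with one_mem_v_inverse[OF assms] have "x \<otimes> \<one> \<in> H" "x \<in> quotient_group G H"
    by (auto simp: v_closure_iff)
  then show "x \<in> H" by simp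
qed

lemma divisorial_v_closure: "Y \<subseteq> H \<Longrightarrow> divisorial_ideal G H (v_closure G H Y)"
  unfolding divisorial_ideal_def using v_closure_subset v_closure_idem mem_quotient_group
  by (metis subset_iff)

lemma divisorial_idealD:
  assumes "divisorial_ideal G H I"
  shows "I \<subseteq> H" "v_closure G H I = I"
  using assms by (auto simp: divisorial_ideal_def)

lemma v_closure_least:
  assumes "divisorial_ideal G H I" "Y \<subseteq> I"
  shows "v_closure G H Y \<subseteq> I"
  using v_closure_mono[OF assms(2)] divisorial_idealD(2)[OF assms(1)] by simp

lemma divisorial_self: "divisorial_ideal G H H"
  unfolding divisorial_ideal_def
  using v_closure_subset[of H] subset_v_closure[of H] mem_quotient_group by blast

text \<open>Extends a containment from generators to their closure: for \<open>z\<close> in the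
  inverse of \<open>I\<close>, the product \<open>z \<otimes> x\<close> lies in the inverse of
  \<open>Y\<close>, hence multiplies \<open>w\<close> into \<open>H\<close>.\<close>

lemma divisorial_mult_v_closure:
  assumes I: "divisorial_ideal G H I" and x: "x \<in> quotient_group G H"
    and Y: "Y \<subseteq> quotient_group G H" and sub: "\<And>y. y \<in> Y \<Longrightarrow> x \<otimes> y \<in> I"
    and w: "w \<in> v_closure G H Y"
  shows "x \<otimes> w \<in> I"
proof -
  have wK: "w \<in> quotient_group G H" using w v_closure_subset_quotient by blast
  have "(x \<otimes> w) \<otimes> z \<in> H" if z: "z \<in> v_inverse G H I" for z
  proof -
    have zK: "z \<in> quotient_group G H" using z v_inverse_subset by blast
    have "(z \<otimes> x) \<otimes> y \<in> H" if "y \<in> Y" for y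
    proof -
      have "z \<otimes> (x \<otimes> y) \<in> H" using z sub[OF that] by (auto simp: v_inverse_iff)
      moreover have "z \<otimes> (x \<otimes> y) = (z \<otimes> x) \<otimes> y"
        using zK x Y that by (auto simp: m_assoc subset_iff)
      ultimately show ?thesis by simp
    qed
    then have "z \<otimes> x \<in> v_inverse G H Y" using zK x by (simp add: v_inverse_iff)
    then have "w \<otimes> (z \<otimes> x) \<in> H" using w by (auto simp: v_closure_iff)
    moreover have "w \<otimes> (z \<otimes> x) = (x \<otimes> w) \<otimes> z"
      using wK zK x by (simp add: m_ac)
    ultimately show ?thesis by simp
  qed
  then have "x \<otimes> w \<in> v_closure G H I" using wK x by (simp add: v_closure_iff)
  then show ?thesis using divisorial_idealD(2)[OF I] by simp
qed

lemma divisorial_mult_closed: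
  assumes "divisorial_ideal G H I" "x \<in> I" "h \<in> H"
  shows "x \<otimes> h \<in> I"
proof -
  have xH: "x \<in> H" using assms divisorial_idealD(1) by blast
  have "h \<otimes> x \<in> H \<and> (\<forall>z\<in>v_inverse G H I. (h \<otimes> x) \<otimes> z \<in> H)"
  proof (intro conjI ballI)
    fix z assume z: "z \<in> v_inverse G H I"
    then have zK: "z \<in> quotient_group G H" using v_inverse_subset by blast
    have "z \<otimes> x \<in> H" using z assms(2) by (auto simp: v_inverse_iff)
    then have "h \<otimes> (z \<otimes> x) \<in> H" using assms(3) by simp
    also have "h \<otimes> (z \<otimes> x) = (h \<otimes> x) \<otimes> z" using zK xH assms(3) by (simp add: m_ac)
    finally show "(h \<otimes> x) \<otimes> z \<in> H" .
  qed (use xH assms(3) in simp)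
  then have "h \<otimes> x \<in> v_closure G H I" by (simp add: v_closure_iff)
  then show ?thesis
    using divisorial_idealD(2)[OF assms(1)] xH assms(3) by (simp add: m_comm)
qed

lemma s_ideal_iff: "s_ideal G H I \<longleftrightarrow> I \<subseteq> H \<and> (\<forall>x\<in>I. \<forall>h\<in>H. x \<otimes> h \<in> I)"
proof
  assume "s_ideal G H I"
  then show "I \<subseteq> H \<and> (\<forall>x\<in>I. \<forall>h\<in>H. x \<otimes> h \<in> I)"
    unfolding s_ideal_def set_mult_def by blast
next
  assume *: "I \<subseteq> H \<and> (\<forall>x\<in>I. \<forall>h\<in>H. x \<otimes> h \<in> I)"
  have "x \<in> I <#> H" if "x \<in> I" for x
  proof -
    have "x = x \<otimes> \<one>" using that * by auto
    then show ?thesis unfolding set_mult_def using that one_closed by blast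
  qed
  with * show "s_ideal G H I" unfolding s_ideal_def set_mult_def by auto
qed

lemma s_ideal_mult_closed: "s_ideal G H I \<Longrightarrow> x \<in> I \<Longrightarrow> h \<in> H \<Longrightarrow> x \<otimes> h \<in> I"
  by (simp add: s_ideal_iff)

lemma s_ideal_mult_closed': "s_ideal G H I \<Longrightarrow> x \<in> I \<Longrightarrow> h \<in> H \<Longrightarrow> h \<otimes> x \<in> I"
  by (metis m_comm mem_carrier s_ideal_iff subset_iff)

lemma divisorial_s_ideal: "divisorial_ideal G H I \<Longrightarrow> s_ideal G H I"
  by (simp add: s_ideal_iff divisorial_mult_closed divisorial_idealD(1))

text \<open>Closing a factor first does not change the inverse of the product. This lets a
  factorization, built one prime at a time, be written with a single closure on the outside.\<close>

lemma v_closure_set_mult: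
  assumes A: "A \<subseteq> quotient_group G H" and B: "B \<subseteq> quotient_group G H"
  shows "v_closure G H (v_closure G H A <#> B) = v_closure G H (A <#> B)"
proof -
  have "v_inverse G H (v_closure G H A <#> B) = v_inverse G H (A <#> B)"
  proof
    show "v_inverse G H (v_closure G H A <#> B) \<subseteq> v_inverse G H (A <#> B)"
      using subset_v_closure[OF A] by (intro v_inverse_antimono) (auto simp: set_mult_def)
  next
    show "v_inverse G H (A <#> B) \<subseteq> v_inverse G H (v_closure G H A <#> B)"
    proof
      fix w assume w: "w \<in> v_inverse G H (A <#> B)"
      then have wK: "w \<in> quotient_group G H" using v_inverse_subset by blast
      have "w \<otimes> (x \<otimes> b) \<in> H" if x: "x \<in> v_closure G H A" and b: "b \<in> B" for x b
      proof -
        have xK: "x \<in> quotient_group G H" using x v_closure_subset_quotient by blast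
        have bK: "b \<in> quotient_group G H" using b B by blast
        have "(w \<otimes> b) \<otimes> a \<in> H" if "a \<in> A" for a
        proof -
          have "w \<otimes> (a \<otimes> b) \<in> H" using w that b by (auto simp: v_inverse_iff set_mult_def)
          moreover have "a \<in> carrier G" using that A by auto
          ultimately show ?thesis using wK bK by (simp add: m_ac)
        qed
        then have "w \<otimes> b \<in> v_inverse G H A" using wK bK by (simp add: v_inverse_iff)
        then have "x \<otimes> (w \<otimes> b) \<in> H" using x by (auto simp: v_closure_iff)
        then show ?thesis using wK bK xK by (simp add: m_ac)
      qed
      then show "w \<in> v_inverse G H (v_closure G H A <#> B)"
        using wK by (auto simp: v_inverse_iff set_mult_def)
    qed
  qed
  then show ?thesis by (simp add: v_closure_def)
qed

lemma prime_s_idealD: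
  assumes "prime_s_ideal G H P"
  shows "s_ideal G H P" "P \<subseteq> H" "\<one> \<notin> P"
    "\<And>x y. x \<in> H \<Longrightarrow> y \<in> H \<Longrightarrow> x \<notin> P \<Longrightarrow> y \<notin> P \<Longrightarrow> x \<otimes> y \<notin> P"
proof -
  interpret C: submonoid "H - P" G using assms by (simp add: prime_s_ideal_def)
  show "s_ideal G H P" using assms by (simp add: prime_s_ideal_def)
  then show "P \<subseteq> H" by (simp add: s_ideal_iff)
  show "\<one> \<notin> P" using C.one_closed by blast
  show "x \<otimes> y \<notin> P" if "x \<in> H" "y \<in> H" "x \<notin> P" "y \<notin> P" for x y
    using C.m_closed[of x y] that by blast
qed

lemma prime_s_ideal_pow:
  assumes "prime_s_ideal G H P" "x \<in> H" "x \<notin> P"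
  shows "x [^] (n::nat) \<notin> P"
  using assms by (induction n) (simp_all add: prime_s_idealD(3,4))

lemma prime_s_idealI:
  assumes "s_ideal G H P" "\<one> \<notin> P"
    and "\<And>x y. x \<in> H \<Longrightarrow> y \<in> H \<Longrightarrow> x \<notin> P \<Longrightarrow> y \<notin> P \<Longrightarrow> x \<otimes> y \<notin> P"
  shows "prime_s_ideal G H P"
  unfolding prime_s_ideal_def
proof (intro conjI)
  show "P \<noteq> H" using assms(2) one_closed by blast
  show "submonoid (H - P) G" using assms(2,3) by unfold_locales auto
qed (rule assms)

section \<open>Multiplication of s-ideals\<close>

lemma set_mult_comm:
  assumes "A \<subseteq> H" "B \<subseteq> H"
  shows "A <#> B = B <#> A"
proof -
  have "x \<otimes> y = y \<otimes> x" if "x \<in> A" "y \<in> B" for x y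
    using that assms by (intro m_comm) auto
  then show ?thesis unfolding set_mult_def by fastforce
qed

lemma set_mult_s_ideal:
  assumes "s_ideal G H I" "s_ideal G H J"
  shows "s_ideal G H (I <#> J)"
  unfolding s_ideal_iff
proof (intro conjI ballI)
  show "I <#> J \<subseteq> H" using assms by (auto simp: s_ideal_iff set_mult_def subset_iff)
  fix x h assume "x \<in> I <#> J" and h: "h \<in> H"
  then obtain i j where *: "x = i \<otimes> j" "i \<in> I" "j \<in> J" by (auto simp: set_mult_def)
  then have "i \<in> H" "j \<in> H" using assms by (auto simp: s_ideal_iff)
  then have "x \<otimes> h = i \<otimes> (j \<otimes> h)" using * h by (simp add: m_assoc)
  moreover have "j \<otimes> h \<in> J" using assms(2) *(3) h by (rule s_ideal_mult_closed)
  ultimately show "x \<otimes> h \<in> I <#> J" using *(2) by (auto simp: set_mult_def)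
qed

lemma s_ideal_self: "s_ideal G H H"
  by (simp add: s_ideal_iff)

lemma s_ideal_monoid_simps [simp]:
  "carrier (s_ideal_monoid G H) = {I. s_ideal G H I}"
  "I \<otimes>\<^bsub>s_ideal_monoid G H\<^esub> J = I <#> J"
  "\<one>\<^bsub>s_ideal_monoid G H\<^esub> = H"
  by (auto simp: s_ideal_monoid_def)

text \<open>Makes the laws of \<open>finprod\<close> and of powers applicable to the products
  occurring in \<open>v_factorization\<close>.\<close>

lemma comm_monoid_s_ideal_monoid: "comm_monoid (s_ideal_monoid G H)"
proof (rule comm_monoidI)
  fix I J assume IJ: "I \<in> carrier (s_ideal_monoid G H)" "J \<in> carrier (s_ideal_monoid G H)"
  then show "I \<otimes>\<^bsub>s_ideal_monoid G H\<^esub> J \<in> carrier (s_ideal_monoid G H)"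
    by (simp add: set_mult_s_ideal)
  show comm: "I \<otimes>\<^bsub>s_ideal_monoid G H\<^esub> J = J \<otimes>\<^bsub>s_ideal_monoid G H\<^esub> I"
    using IJ set_mult_comm by (simp add: s_ideal_iff)
  fix L assume "L \<in> carrier (s_ideal_monoid G H)"
  then show "(I \<otimes>\<^bsub>s_ideal_monoid G H\<^esub> J) \<otimes>\<^bsub>s_ideal_monoid G H\<^esub> L
      = I \<otimes>\<^bsub>s_ideal_monoid G H\<^esub> (J \<otimes>\<^bsub>s_ideal_monoid G H\<^esub> L)"
    using IJ set_mult_assoc[of I J L] subset by (auto simp: s_ideal_iff)
next
  fix I assume "I \<in> carrier (s_ideal_monoid G H)"
  then have "s_ideal G H I" by simp
  then have "I <#> H = I" "I \<subseteq> H" by (auto simp: s_ideal_def)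
  moreover have "H <#> I = I <#> H" using \<open>I \<subseteq> H\<close> by (intro set_mult_comm) auto
  ultimately show "\<one>\<^bsub>s_ideal_monoid G H\<^esub> \<otimes>\<^bsub>s_ideal_monoid G H\<^esub> I = I" by simp
qed (simp add: s_ideal_self)

end

sublocale comm_group_submonoid \<subseteq> ideals: comm_monoid "s_ideal_monoid G H"
  by (rule comm_monoid_s_ideal_monoid)


section \<open>Factorization of divisorial ideals in Krull monoids\<close>

locale krull = comm_group G for G (structure) and H +
  assumes krull_monoid: "krull_monoid G H"

sublocale krull \<subseteq> comm_group_submonoid G H
  using krull_monoid
  by (intro comm_group_submonoid.intro comm_group_axioms) (simp add: krull_monoid_def mori_monoid_def)

context krull
begin

lemma completely_integrally_closedD:
  assumes "z \<in> quotient_group G H" "c \<in> H" "\<And>n::nat. c \<otimes> z [^] n \<in> H"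
  shows "z \<in> H"
  using krull_monoid assms unfolding krull_monoid_def completely_integrally_closed_def by blast

text \<open>For a fixed \<open>c\<close> in \<open>I\<close>, all \<open>c \<otimes> z [^] n\<close>
  stay in \<open>I\<close>, so complete integral closedness puts \<open>z\<close> into
  \<open>H\<close>.\<close>

lemma ideal_stable:
  assumes z: "z \<in> quotient_group G H" and I: "I \<subseteq> H" "I \<noteq> {}"
    and st: "\<And>a. a \<in> I \<Longrightarrow> a \<otimes> z \<in> I"
  shows "z \<in> H"
proof -
  obtain c where c: "c \<in> I" using I by blast
  have "c \<otimes> z [^] n \<in> I" for n :: nat
  proof (induction n)
    case (Suc n)
    then have "c \<otimes> z [^] n \<otimes> z \<in> I" by (rule st)
    then show ?case using c z I by (simp add: m_assoc subset_iff)
  qed (use c I in auto)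
  then show ?thesis using completely_integrally_closedD[OF z, of c] c I by auto
qed

text \<open>Starting from \<open>\<one>\<close>, all powers of \<open>z\<close> stay in the inverse
  of \<open>Y\<close>, so any element of \<open>Y\<close> serves as their common
  denominator.\<close>

lemma v_inverse_stable:
  assumes z: "z \<in> quotient_group G H" and Y: "Y \<subseteq> H" "Y \<noteq> {}"
    and st: "\<And>a. a \<in> v_inverse G H Y \<Longrightarrow> z \<otimes> a \<in> v_inverse G H Y"
  shows "z \<in> H"
proof -
  obtain c where c: "c \<in> Y" using Y by blast
  have *: "z [^] n \<in> v_inverse G H Y" for n :: nat
  proof (induction n)
    case (Suc n)
    then have "z \<otimes> z [^] n \<in> v_inverse G H Y" by (rule st)
    then show ?case using z by (simp add: m_comm)
  qed (use one_mem_v_inverse Y in auto)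
  have "c \<otimes> z [^] n \<in> H" for n :: nat
    using *[of n] c Y z by (auto simp: v_inverse_iff subset_iff m_comm[of c])
  then show ?thesis using completely_integrally_closedD[OF z, of c] c Y by blast
qed

text \<open>The ascending chain condition as well-foundedness of reverse strict inclusion. It
  supplies maximal elements and allows induction from larger ideals to smaller ones.\<close>

lemma divisorial_wf:
  "wf {(J, I). divisorial_ideal G H I \<and> divisorial_ideal G H J \<and> I \<subset> J}"
  unfolding wf_iff_no_infinite_down_chain
proof
  assume "\<exists>f. \<forall>i::nat. (f (Suc i), f i) \<in> {(J, I). divisorial_ideal G H I \<and> divisorial_ideal G H J \<and> I \<subset> J}"
  then obtain f where f: "\<And>i::nat. divisorial_ideal G H (f i)" "\<And>i. f i \<subset> f (Suc i)" by blast
  have "\<exists>N. \<forall>n\<ge>N. f n = f N"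
    using krull_monoid f unfolding krull_monoid_def mori_monoid_def psubset_eq by simp
  then obtain N where "\<forall>n\<ge>N. f n = f N" by (rule exE)
  then have "f (Suc N) = f N" by (rule allE[of _ "Suc N"]) simp
  with f(2)[of N] show False by blast
qed

text \<open>Stands in for height-one primes, which are defined by minimality among primes;
  \<open>v_max_height_one\<close> and \<open>height_one_v_max\<close> show that the two notions
  agree.\<close>

definition v_max :: "'a set \<Rightarrow> bool" where
  "v_max M \<longleftrightarrow> divisorial_ideal G H M \<and> M \<noteq> H \<and> M \<noteq> {} \<and>
     (\<forall>J. divisorial_ideal G H J \<and> M \<subset> J \<longrightarrow> J = H)"

lemma v_max_exists:
  assumes "divisorial_ideal G H I" "I \<noteq> {}" "I \<noteq> H"
  obtains M where "v_max M" "I \<subseteq> M"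
proof -
  let ?A = "{J. divisorial_ideal G H J \<and> J \<noteq> H \<and> I \<subseteq> J}"
  have "I \<in> ?A" using assms by blast
  with divisorial_wf show thesis
  proof (rule wfE_min)
    fix M assume M: "M \<in> ?A"
      and max: "\<And>J. (J, M) \<in> {(J, I). divisorial_ideal G H I \<and> divisorial_ideal G H J \<and> I \<subset> J} \<Longrightarrow> J \<notin> ?A"
    have "J = H" if "divisorial_ideal G H J" "M \<subset> J" for J
      using max[of J] M that by auto
    then have "v_max M" unfolding v_max_def using M assms(2) by auto
    with M show thesis by (intro that[of M]) auto
  qed
qed

lemma divisorial_proper_no_one:
  assumes "divisorial_ideal G H M" "M \<noteq> H"
  shows "\<one> \<notin> M"
proof
  assume "\<one> \<in> M"
  then have "\<one> \<otimes> h \<in> M" if "h \<in> H" for h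
    using divisorial_mult_closed[OF assms(1) _ that] by simp
  then have "H \<subseteq> M" by auto
  with assms divisorial_idealD(1) show False by blast
qed

text \<open>Otherwise \<open>\<one>\<close> would lie in the closure of \<open>M\<close>. This is
  the contradiction reached whenever a stability argument forces the inverse of \<open>M\<close>
  into \<open>H\<close>.\<close>

lemma divisorial_proper_v_inverse:
  assumes "divisorial_ideal G H M" "M \<noteq> H"
  shows "\<not> v_inverse G H M \<subseteq> H"
proof
  assume "v_inverse G H M \<subseteq> H"
  then have "\<forall>z\<in>v_inverse G H M. \<one> \<otimes> z \<in> H" by auto
  then have "\<one> \<in> v_closure G H M" by (simp add: v_closure_iff)
  with divisorial_proper_no_one[OF assms] divisorial_idealD(2)[OF assms(1)] show False by simp
qed

text \<open>If \<open>x \<otimes> y\<close> lies in \<open>M\<close> and \<open>y\<close> does not,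
  maximality makes \<open>H\<close> the closure of \<open>insert y M\<close>. As \<open>x\<close>
  multiplies this closure into \<open>M\<close>, taking \<open>\<one>\<close> gives \<open>x\<close>
  in \<open>M\<close>.\<close>

lemma v_max_prime:
  assumes "v_max M"
  shows "prime_s_ideal G H M"
proof (rule prime_s_idealI)
  have div: "divisorial_ideal G H M" and MH: "M \<noteq> H"
    and max: "\<And>J. divisorial_ideal G H J \<Longrightarrow> M \<subset> J \<Longrightarrow> J = H"
    using assms unfolding v_max_def by blast+
  show s: "s_ideal G H M" using div by (rule divisorial_s_ideal)
  show "\<one> \<notin> M" using div MH by (rule divisorial_proper_no_one)
  fix x y assume xy: "x \<in> H" "y \<in> H" "x \<notin> M" "y \<notin> M"
  show "x \<otimes> y \<notin> M"
  proof
    assume xyM: "x \<otimes> y \<in> M"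
    let ?Y = "insert y M"
    have YH: "?Y \<subseteq> H" using xy divisorial_idealD(1)[OF div] by blast
    then have YK: "?Y \<subseteq> quotient_group G H" using mem_quotient_group by blast
    have "M \<subset> v_closure G H ?Y" using subset_v_closure[OF YK] xy(4) by blast
    then have "v_closure G H ?Y = H" by (rule max[OF divisorial_v_closure[OF YH]])
    then have "\<one> \<in> v_closure G H ?Y" by simp
    moreover have "x \<otimes> w \<in> M" if "w \<in> ?Y" for w
      using that xyM s_ideal_mult_closed'[OF s _ xy(1), of w] by auto
    ultimately have "x \<otimes> \<one> \<in> M"
      by (rule divisorial_mult_v_closure[OF div mem_quotient_group[OF xy(1)] YK, rotated])
    then show False using xy by simp
  qed
qed

text \<open>Splits the factor \<open>M\<close> off \<open>I\<close>; the cofactor is the closure of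
  \<open>I\<close> times the inverse of \<open>M\<close>. Its being strictly larger drives the
  induction in \<open>v_max_factorization\<close>.\<close>

lemma v_max_factor:
  assumes I: "divisorial_ideal G H I" "I \<noteq> {}" and M: "v_max M" and IM: "I \<subseteq> M"
  obtains J where "divisorial_ideal G H J" "I \<subset> J" "I = v_closure G H (J <#> M)"
proof -
  define W where "W = v_inverse G H M"
  define J where "J = v_closure G H (I <#> W)"
  have Mdiv: "divisorial_ideal G H M" and MH: "M \<noteq> H" "M \<subseteq> H" "M \<noteq> {}"
    using M divisorial_idealD(1)[of M] by (auto simp: v_max_def)
  have IH: "I \<subseteq> H" by (rule divisorial_idealD(1)[OF I(1)])
  have WK: "W \<subseteq> quotient_group G H" unfolding W_def by (rule v_inverse_subset)
  have W: "z \<otimes> m \<in> H" if "z \<in> W" "m \<in> M" for z m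
    using that by (auto simp: W_def v_inverse_iff)
  have IWH: "I <#> W \<subseteq> H"
  proof
    fix x assume "x \<in> I <#> W"
    then obtain i z where *: "x = i \<otimes> z" "i \<in> I" "z \<in> W" by (auto simp: set_mult_def)
    then have "z \<otimes> i \<in> H" using IM W by blast
    with * show "x \<in> H" using IH WK by (auto simp: m_comm subset_iff)
  qed
  then have IWK: "I <#> W \<subseteq> quotient_group G H" using mem_quotient_group by blast
  have Jdiv: "divisorial_ideal G H J" unfolding J_def using IWH by (rule divisorial_v_closure)
  have "I \<subseteq> I <#> W"
  proof
    fix i assume i: "i \<in> I"
    have "\<one> \<in> W" unfolding W_def using MH(2) by (rule one_mem_v_inverse)
    moreover have "i = i \<otimes> \<one>" using i IH by auto
    ultimately show "i \<in> I <#> W" using i unfolding set_mult_def by blast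
  qed
  then have IJ: "I \<subseteq> J" unfolding J_def using subset_v_closure[OF IWK] by blast
  \<comment> \<open>Equality would make \<open>I\<close> stable under the whole inverse of
    \<open>M\<close>, which \<open>ideal_stable\<close> would then place inside
    \<open>H\<close>.\<close>
  have "I \<noteq> J"
  proof
    assume eq: "I = J"
    have "z \<in> H" if z: "z \<in> W" for z
    proof (rule ideal_stable[OF _ IH I(2)])
      show "z \<in> quotient_group G H" using z WK by blast
      show "a \<otimes> z \<in> I" if "a \<in> I" for a
      proof -
        have "a \<otimes> z \<in> I <#> W" using z that by (auto simp: set_mult_def)
        then have "a \<otimes> z \<in> J" unfolding J_def using subset_v_closure[OF IWK] by blast
        then show ?thesis using eq by simp
      qed
    qed
    then show False using divisorial_proper_v_inverse[OF Mdiv MH(1)] by (auto simp: W_def)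
  qed
  have JH: "J \<subseteq> H" by (rule divisorial_idealD(1)[OF Jdiv])
  have JM: "J <#> M \<subseteq> I"
  proof
    fix x assume "x \<in> J <#> M"
    then obtain j m where *: "x = j \<otimes> m" "j \<in> J" "m \<in> M" by (auto simp: set_mult_def)
    have mH: "m \<in> H" using * MH by blast
    \<comment> \<open>Regrouping \<open>m \<otimes> (i \<otimes> z)\<close> as
      \<open>i \<otimes> (z \<otimes> m)\<close> works because \<open>z \<otimes> m\<close> lies in
      \<open>H\<close>; the closure of \<open>I <#> W\<close> then follows.\<close>
    have "m \<otimes> y \<in> I" if yIW: "y \<in> I <#> W" for y
    proof -
      obtain i z where y: "y = i \<otimes> z" "i \<in> I" "z \<in> W" using yIW by (auto simp: set_mult_def)
      then have "i \<otimes> (z \<otimes> m) \<in> I" using W[OF y(3) *(3)] divisorial_mult_closed[OF I(1)] by auto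
      moreover have "i \<in> carrier G" "z \<in> carrier G" using y IH WK by auto
      ultimately show ?thesis using mH y by (simp add: m_ac)
    qed
    then have "m \<otimes> j \<in> I"
      using *(2) unfolding J_def
      by (rule divisorial_mult_v_closure[OF I(1) mem_quotient_group[OF mH] IWK])
    then show "x \<in> I" using * mH JH by (auto simp: m_comm subset_iff)
  qed
  have "I \<subseteq> v_closure G H (J <#> M)"
  proof
    fix i assume i: "i \<in> I"
    then have iH: "i \<in> H" using IH by blast
    \<comment> \<open>Multiplication by \<open>i \<otimes> w\<close> maps the inverse of
      \<open>M\<close> into itself, since \<open>i \<otimes> z\<close> is in \<open>J\<close> for
      every \<open>z\<close> in that inverse.\<close>
    have "i \<otimes> w \<in> H" if w: "w \<in> v_inverse G H (J <#> M)" for w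
    proof (rule v_inverse_stable[OF _ MH(2,3)])
      have wK: "w \<in> quotient_group G H" using w v_inverse_subset by blast
      show "i \<otimes> w \<in> quotient_group G H" using wK iH by simp
      fix z assume z: "z \<in> v_inverse G H M"
      then have zK: "z \<in> quotient_group G H" using v_inverse_subset by blast
      have izJ: "i \<otimes> z \<in> J"
        using subset_v_closure[OF IWK] i z by (auto simp: J_def W_def set_mult_def)
      have "i \<otimes> w \<otimes> z \<otimes> m \<in> H" if m: "m \<in> M" for m
      proof -
        have "w \<otimes> (i \<otimes> z \<otimes> m) \<in> H"
          using w izJ m by (auto simp: v_inverse_iff set_mult_def)
        moreover have "m \<in> carrier G" using m MH by auto
        ultimately show ?thesis using wK zK iH by (simp add: m_ac)
      qed
      then show "i \<otimes> w \<otimes> z \<in> v_inverse G H M"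
        using wK zK iH by (simp add: v_inverse_iff)
    qed
    then show "i \<in> v_closure G H (J <#> M)" using iH by (simp add: v_closure_iff)
  qed
  moreover have "v_closure G H (J <#> M) \<subseteq> I" by (rule v_closure_least[OF I(1) JM])
  ultimately have "I = v_closure G H (J <#> M)" by blast
  with that Jdiv IJ \<open>I \<noteq> J\<close> show thesis by blast
qed

section \<open>Products of powers of s-ideals and existence of factorizations\<close>

abbreviation v_product :: "('a set \<Rightarrow> nat) \<Rightarrow> 'a set set \<Rightarrow> 'a set" where
  "v_product e A \<equiv> (\<Otimes>\<^bsub>s_ideal_monoid G H\<^esub>Q\<in>A. Q [^]\<^bsub>s_ideal_monoid G H\<^esub> e Q)"

lemma v_max_s_ideal: "v_max M \<Longrightarrow> s_ideal G H M"
  by (auto simp: v_max_def divisorial_s_ideal)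

lemma s_ideal_pow: "s_ideal G H Q \<Longrightarrow> s_ideal G H (Q [^]\<^bsub>s_ideal_monoid G H\<^esub> (n::nat))"
  using ideals.nat_pow_closed[of Q n] by simp

lemma v_product_s_ideal: "A \<subseteq> {Q. s_ideal G H Q} \<Longrightarrow> s_ideal G H (v_product e A)"
  using ideals.finprod_closed[of "\<lambda>Q. Q [^]\<^bsub>s_ideal_monoid G H\<^esub> e Q" A] s_ideal_pow
  by (auto simp: Pi_iff subset_iff)

lemma v_product_insert:
  assumes "finite A" "A \<subseteq> {Q. s_ideal G H Q}" "s_ideal G H M" "M \<notin> A"
  shows "v_product e (insert M A) = M [^]\<^bsub>s_ideal_monoid G H\<^esub> e M <#> v_product e A"
proof -
  have "v_product e (insert M A) = M [^]\<^bsub>s_ideal_monoid G H\<^esub> e M \<otimes>\<^bsub>s_ideal_monoid G H\<^esub> v_product e A"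
    by (rule ideals.finprod_insert) (use assms s_ideal_pow in auto)
  then show ?thesis by simp
qed

text \<open>Multiplying by \<open>M\<close> raises its exponent by one. Both sides are compared
  after isolating the power of \<open>M\<close>, so it does not matter whether \<open>M\<close>
  occurred before.\<close>

lemma v_product_fun_upd:
  assumes A: "finite A" "A \<subseteq> {Q. s_ideal G H Q}" "{Q. e Q \<noteq> 0} \<subseteq> A" and M: "s_ideal G H M"
  shows "v_product (e(M := Suc (e M))) (insert M A) = v_product e A <#> M"
proof -
  let ?p = "\<lambda>Q n. Q [^]\<^bsub>s_ideal_monoid G H\<^esub> (n::nat)"
  have cl: "\<And>Q n. Q \<in> insert M A \<Longrightarrow> s_ideal G H (?p Q n)" using A M s_ideal_pow by blast
  have split: "v_product f (insert M A) = ?p M (f M) <#> v_product f (A - {M})" for f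
    using v_product_insert[of "A - {M}" M f] A M by auto
  \<comment> \<open>A new index has exponent 0 and contributes \<open>H\<close>, the
    identity.\<close>
  have A': "v_product e (insert M A) = v_product e A"
  proof (cases "M \<in> A")
    case False
    then have "e M = 0" using A(3) by blast
    have "v_product e (insert M A) = ?p M (e M) <#> v_product e A"
      by (rule v_product_insert[OF A(1,2) M False])
    also have "\<dots> = v_product e A"
      using \<open>e M = 0\<close> v_product_s_ideal[OF A(2), of e] ideals.l_one[of "v_product e A"] by simp
    finally show ?thesis .
  qed (simp add: insert_absorb)
  have eq: "v_product (e(M := Suc (e M))) (A - {M}) = v_product e (A - {M})"
    by (rule ideals.finprod_cong') (use cl in auto)
  have D: "s_ideal G H (v_product e (A - {M}))" using A by (intro v_product_s_ideal) blast
  have "v_product (e(M := Suc (e M))) (insert M A)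
      = (?p M (e M) \<otimes>\<^bsub>s_ideal_monoid G H\<^esub> M) \<otimes>\<^bsub>s_ideal_monoid G H\<^esub> v_product e (A - {M})"
    by (subst split) (simp only: eq fun_upd_same s_ideal_monoid_simps(2) ideals.nat_pow_Suc)
  also have "\<dots> = (?p M (e M) \<otimes>\<^bsub>s_ideal_monoid G H\<^esub> v_product e (A - {M})) \<otimes>\<^bsub>s_ideal_monoid G H\<^esub> M"
    using M D s_ideal_pow[OF M, of "e M"]
    by (simp only: ideals.m_ac s_ideal_monoid_simps(1) mem_Collect_eq)
  also have "\<dots> = v_product e A <#> M" using split[of e] A' by simp
  finally show ?thesis .
qed

text \<open>Induction along \<open>divisorial_wf\<close>: a proper \<open>I\<close> lies in some
  maximal \<open>M\<close>, and \<open>v_max_factor\<close> reduces to a strictly larger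
  \<open>J\<close>. The ideal \<open>H\<close> is the empty product.\<close>

lemma v_max_factorization:
  assumes "divisorial_ideal G H I" "I \<noteq> {}"
  shows "\<exists>e. finite {Q. e Q \<noteq> 0} \<and> {Q. e Q \<noteq> 0} \<subseteq> Collect v_max \<and>
    I = v_closure G H (v_product e {Q. e Q \<noteq> 0})"
  using assms
proof (induction I rule: wf_induct_rule[OF divisorial_wf])
  case (1 I)
  show ?case
  proof (cases "I = H")
    case True
    then show ?thesis
      using divisorial_idealD(2)[OF divisorial_self] by (intro exI[of _ "\<lambda>_. 0"]) simp
  next
    case False
    obtain M where M: "v_max M" "I \<subseteq> M" using v_max_exists[OF "1.prems" False] by blast
    obtain J where J: "divisorial_ideal G H J" "I \<subset> J" "I = v_closure G H (J <#> M)"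
      using v_max_factor[OF "1.prems" M] by blast
    then obtain e where e: "finite {Q. e Q \<noteq> 0}" "{Q. e Q \<noteq> 0} \<subseteq> Collect v_max"
      "J = v_closure G H (v_product e {Q. e Q \<noteq> 0})"
      using "1.IH"[of J] "1.prems" by auto
    define e' where "e' = e(M := Suc (e M))"
    have supp: "{Q. e' Q \<noteq> 0} = insert M {Q. e Q \<noteq> 0}" by (auto simp: e'_def)
    have sI: "{Q. e Q \<noteq> 0} \<subseteq> {Q. s_ideal G H Q}" using e(2) v_max_s_ideal by blast
    have "v_product e {Q. e Q \<noteq> 0} \<subseteq> quotient_group G H"
      using v_product_s_ideal[OF sI, of e] by (auto simp: s_ideal_iff)
    moreover have "M \<subseteq> quotient_group G H" using v_max_s_ideal[OF M(1)] by (auto simp: s_ideal_iff)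
    ultimately have "I = v_closure G H (v_product e {Q. e Q \<noteq> 0} <#> M)"
      using J(3) e(3) v_closure_set_mult by metis
    also have "\<dots> = v_closure G H (v_product e' {Q. e' Q \<noteq> 0})"
      unfolding supp unfolding e'_def
      using v_product_fun_upd[OF e(1) sI order_refl v_max_s_ideal[OF M(1)]] by simp
    finally have "I = v_closure G H (v_product e' {Q. e' Q \<noteq> 0})" .
    moreover have "finite {Q. e' Q \<noteq> 0}" unfolding supp using e(1) by simp
    moreover have "{Q. e' Q \<noteq> 0} \<subseteq> Collect v_max" unfolding supp using e(2) M(1) by blast
    ultimately show ?thesis by blast
  qed
qed

text \<open>If the inverse of \<open>M\<close> multiplied \<open>M\<close> into itself, that inverse
  would be closed under multiplication, and \<open>v_inverse_stable\<close> would force it into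
  \<open>H\<close>.\<close>

lemma v_max_uniformizer:
  assumes "v_max M"
  obtains z p where "p \<in> M" "z \<in> v_inverse G H M" "z \<otimes> p \<notin> M"
proof (rule ccontr)
  assume "\<not> thesis"
  with that have *: "z \<otimes> p \<in> M" if "p \<in> M" "z \<in> v_inverse G H M" for z p
    using that by blast
  have M: "divisorial_ideal G H M" "M \<noteq> H" "M \<noteq> {}" "M \<subseteq> H"
    using assms divisorial_idealD(1)[of M] by (auto simp: v_max_def)
  have "z \<in> H" if z: "z \<in> v_inverse G H M" for z
  proof (rule v_inverse_stable[OF _ M(4,3)])
    show zK: "z \<in> quotient_group G H" using z v_inverse_subset by blast
    fix a assume a: "a \<in> v_inverse G H M"
    then have aK: "a \<in> quotient_group G H" using v_inverse_subset by blast
    have "z \<otimes> a \<otimes> m \<in> H" if m: "m \<in> M" for m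
    proof -
      have "z \<otimes> (a \<otimes> m) \<in> H" using z *[OF m a] by (simp add: v_inverse_iff)
      moreover have "m \<in> carrier G" using m M(4) by auto
      ultimately show ?thesis using zK aK by (simp add: m_assoc)
    qed
    then show "z \<otimes> a \<in> v_inverse G H M" using zK aK by (simp add: v_inverse_iff)
  qed
  then show False using divisorial_proper_v_inverse[OF M(1,2)] by blast
qed

text \<open>If every factor met \<open>C\<close>, multiplying chosen common elements would give an
  element of \<open>C\<close> in the product. Applied to the complement of a prime.\<close>

lemma v_product_disjoint_submonoid:
  assumes C: "submonoid C G" "C \<subseteq> H" and A: "finite A" "A \<subseteq> {Q. s_ideal G H Q}"
    and disj: "v_product e A \<inter> C = {}"
  shows "\<exists>Q\<in>A. Q \<inter> C = {}"
proof (rule ccontr)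
  assume no: "\<not> (\<exists>Q\<in>A. Q \<inter> C = {})"
  interpret C: submonoid C G by (rule C(1))
  have H_C: "H \<inter> C \<noteq> {}" using one_closed C.one_closed by blast
  have mult: "(I <#> J) \<inter> C \<noteq> {}" if IJ: "I \<inter> C \<noteq> {}" "J \<inter> C \<noteq> {}" for I J
  proof -
    obtain i j where "i \<in> I" "i \<in> C" "j \<in> J" "j \<in> C" using IJ by blast
    then have "i \<otimes> j \<in> I <#> J" "i \<otimes> j \<in> C" by (auto simp: set_mult_def)
    then show ?thesis by blast
  qed
  have pow: "(Q [^]\<^bsub>s_ideal_monoid G H\<^esub> n) \<inter> C \<noteq> {}" if Q: "Q \<in> A" for Q and n :: nat
  proof (induction n)
    case (Suc n)
    then show ?case using mult no Q by simp
  qed (simp add: H_C)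
  have "v_product e B \<inter> C \<noteq> {}" if "finite B" "B \<subseteq> A" for B
    using that
  proof (induction B)
    case (insert Q B)
    have "Q \<in> A" "v_product e B \<inter> C \<noteq> {}" using insert by auto
    moreover have "B \<subseteq> {Q. s_ideal G H Q}" "s_ideal G H Q" using insert.prems A by auto
    ultimately show ?case
      using v_product_insert[OF insert.hyps(1), of Q e] insert.hyps(2) mult pow by simp
  qed (simp add: H_C)
  then show False using A(1) disj by blast
qed

end

section \<open>The discrete valuation at a prime with a uniformizer\<close>

locale krull_prime = krull G H for G (structure) and H +
  fixes P and z p
  assumes prime: "prime_s_ideal G H P"
    and p_mem: "p \<in> P" and z_mem: "z \<in> v_inverse G H P" and zp_notin: "z \<otimes> p \<notin> P"
begin

lemma P_subset: "P \<subseteq> H"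
  by (rule prime_s_idealD(2)[OF prime])

lemma P_s_ideal: "s_ideal G H P"
  by (rule prime_s_idealD(1)[OF prime])

lemma z_quotient [simp]: "z \<in> quotient_group G H"
  using z_mem by (simp add: v_inverse_iff)

lemma p_closed [simp]: "p \<in> H"
  using p_mem P_subset by blast

lemma z_mult: "x \<in> P \<Longrightarrow> z \<otimes> x \<in> H"
  using z_mem by (simp add: v_inverse_iff)

lemma zp_closed [simp]: "z \<otimes> p \<in> H"
  by (rule z_mult[OF p_mem])

lemma zp_pow_notin: "(z \<otimes> p) [^] (n::nat) \<notin> P"
  by (rule prime_s_ideal_pow[OF prime zp_closed zp_notin])

lemma p_pow_mem: "n > 0 \<Longrightarrow> p [^] (n::nat) \<in> P"
  by (cases n) (auto intro: s_ideal_mult_closed'[OF P_s_ideal p_mem])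

lemma z_notin: "z \<notin> H"
  using s_ideal_mult_closed'[OF P_s_ideal p_mem] zp_notin by blast

text \<open>Compares different powers of \<open>z\<close> without leaving \<open>H\<close>: powers
  of \<open>p\<close> lie in \<open>P\<close> for positive exponents, powers of
  \<open>z \<otimes> p\<close> never do.\<close>

lemma pow_shift:
  assumes "x \<in> H"
  shows "p [^] (k::nat) \<otimes> (z [^] (k + n) \<otimes> x) = (z \<otimes> p) [^] k \<otimes> (z [^] (n::nat) \<otimes> x)"
proof -
  have "(z \<otimes> p) [^] k = z [^] k \<otimes> p [^] k" by (simp add: nat_pow_distrib)
  then show ?thesis using assms by (simp add: nat_pow_mult[symmetric] m_ac)
qed

text \<open>For \<open>m = k + n\<close> with \<open>k > 0\<close>, the left side of
  \<open>pow_shift\<close> lies in \<open>P\<close>, while the right side is a product of two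
  elements outside \<open>P\<close>.\<close>

lemma exponent_le:
  assumes x: "x \<in> H" and n: "z [^] (n::nat) \<otimes> x \<in> H" "z [^] n \<otimes> x \<notin> P" and m: "z [^] (m::nat) \<otimes> x \<in> H"
  shows "m \<le> n"
proof (rule ccontr)
  assume "\<not> m \<le> n"
  then obtain k where k: "m = k + n" "k > 0"
    by (metis add.commute less_imp_add_positive not_le)
  have "p [^] k \<otimes> (z [^] m \<otimes> x) \<in> P"
    using s_ideal_mult_closed[OF P_s_ideal p_pow_mem[OF k(2)] m] .
  moreover have "(z \<otimes> p) [^] k \<otimes> (z [^] n \<otimes> x) \<notin> P"
    by (rule prime_s_idealD(4)[OF prime _ n(1) zp_pow_notin n(2)]) simp
  ultimately show False using pow_shift[OF x, of k n] k by simp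
qed

text \<open>Some \<open>z [^] n \<otimes> x\<close> leaves \<open>H\<close>, as otherwise
  \<open>z\<close> would be in \<open>H\<close>. Just before the first exit the element is not in
  \<open>P\<close>, because \<open>z\<close> multiplies \<open>P\<close> into
  \<open>H\<close>.\<close>

lemma exponent_exists:
  assumes x: "x \<in> H"
  obtains n :: nat where "z [^] n \<otimes> x \<in> H" "z [^] n \<otimes> x \<notin> P"
    "\<And>m. m \<le> n \<Longrightarrow> z [^] m \<otimes> x \<in> H"
proof -
  let ?out = "\<lambda>n::nat. z [^] n \<otimes> x \<notin> H"
  have "\<exists>n. ?out n"
  proof (rule ccontr)
    assume "\<not> (\<exists>n. ?out n)"
    then have "x \<otimes> z [^] n \<in> H" for n :: nat using x by (simp add: m_comm)
    then show False using completely_integrally_closedD[OF z_quotient x] z_notin by blast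
  qed
  then have L: "?out (LEAST n. ?out n)" by (rule LeastI_ex)
  have "(LEAST n. ?out n) \<noteq> 0"
  proof
    assume "(LEAST n. ?out n) = 0"
    with L show False using x by simp
  qed
  then obtain n where n: "(LEAST n. ?out n) = Suc n" using not0_implies_Suc by blast
  have below: "z [^] m \<otimes> x \<in> H" if "m \<le> n" for m
    using not_less_Least[of m ?out] that n by auto
  have "z \<otimes> (z [^] n \<otimes> x) = z [^] Suc n \<otimes> x" using x by (simp add: m_ac)
  then have "z [^] n \<otimes> x \<notin> P" using L z_mult[of "z [^] n \<otimes> x"] by (simp only: n) auto
  with below that show thesis by blast
qed

text \<open>The valuation at \<open>P\<close>, with \<open>z\<close> acting as an inverse
  uniformizer. On \<open>H\<close> the exponent exists by \<open>exponent_exists\<close> and is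
  unique by \<open>exponent_le\<close>.\<close>

definition val :: "'a \<Rightarrow> nat" where
  "val x = (THE n. z [^] n \<otimes> x \<in> H - P)"

lemma val_eqI:
  assumes "x \<in> H" "z [^] n \<otimes> x \<in> H" "z [^] n \<otimes> x \<notin> P"
  shows "val x = n"
  unfolding val_def
proof (rule the_equality)
  fix m :: nat assume "z [^] m \<otimes> x \<in> H - P"
  then show "m = n"
    using exponent_le[OF assms(1), of m n] exponent_le[OF assms(1), of n m] assms by simp
qed (use assms in simp)

lemma val_closed: "x \<in> H \<Longrightarrow> z [^] val x \<otimes> x \<in> H"
  and val_notin: "x \<in> H \<Longrightarrow> z [^] val x \<otimes> x \<notin> P"
  and val_le: "x \<in> H \<Longrightarrow> m \<le> val x \<Longrightarrow> z [^] m \<otimes> x \<in> H"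
  using exponent_exists[of x] val_eqI[of x] by metis+

lemma pow_mult_mem_iff: "x \<in> H \<Longrightarrow> z [^] m \<otimes> x \<in> H \<longleftrightarrow> m \<le> val x"
  using exponent_le[of x "val x" m] val_closed val_notin val_le by blast

lemma val_mult:
  assumes "x \<in> H" "y \<in> H"
  shows "val (x \<otimes> y) = val x + val y"
proof (rule val_eqI)
  have eq: "z [^] (val x + val y) \<otimes> (x \<otimes> y) = (z [^] val x \<otimes> x) \<otimes> (z [^] val y \<otimes> y)"
    using assms by (simp add: nat_pow_mult[symmetric] m_ac)
  show "z [^] (val x + val y) \<otimes> (x \<otimes> y) \<in> H"
    unfolding eq using assms by (intro m_closed val_closed)
  show "z [^] (val x + val y) \<otimes> (x \<otimes> y) \<notin> P"
    unfolding eq using assms by (intro prime_s_idealD(4)[OF prime] val_closed val_notin)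
qed (use assms in simp)

lemma val_eq_0_iff:
  assumes "x \<in> H"
  shows "val x = 0 \<longleftrightarrow> x \<notin> P"
  using val_notin[OF assms] val_eqI[of x 0] assms by auto

lemma val_p: "val p = 1"
  by (rule val_eqI) (use zp_notin in auto)

text \<open>Up to factors outside \<open>P\<close>, \<open>x\<close> is a power of \<open>p\<close>.
  The identity involves only elements of \<open>H\<close>, so it can also be evaluated at a prime of
  a larger monoid.\<close>

lemma val_expansion:
  assumes "x \<in> H"
  shows "p [^] val x \<otimes> (z [^] val x \<otimes> x) = (z \<otimes> p) [^] val x \<otimes> x"
  using pow_shift[OF assms, of "val x" 0] assms by simp

text \<open>For a nonempty prime \<open>Q\<close> inside \<open>P\<close>,
  \<open>val_expansion\<close> of an element of \<open>Q\<close> forces \<open>p\<close> into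
  \<open>Q\<close>. Then \<open>p \<otimes> (z \<otimes> x) = x \<otimes> (z \<otimes> p)\<close>
  forces every \<open>x\<close> of \<open>P\<close> into \<open>Q\<close>.\<close>

lemma height_one: "P \<in> height_one_primes G H"
  unfolding height_one_primes_def
proof (intro CollectI conjI allI impI)
  fix Q assume "prime_s_ideal G H Q \<and> Q \<noteq> {} \<and> Q \<subseteq> P"
  then have Q: "prime_s_ideal G H Q" "Q \<noteq> {}" "Q \<subseteq> P" by auto
  note QI = prime_s_idealD(1)[OF Q(1)]
  obtain a where a: "a \<in> Q" using Q(2) by blast
  then have aH: "a \<in> H" using Q P_subset by blast
  have pQ: "p \<in> Q"
  proof (rule ccontr)
    assume "p \<notin> Q"
    then have "p [^] val a \<notin> Q" by (rule prime_s_ideal_pow[OF Q(1) p_closed])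
    moreover have "z [^] val a \<otimes> a \<notin> Q" using val_notin[OF aH] Q(3) by blast
    ultimately have "p [^] val a \<otimes> (z [^] val a \<otimes> a) \<notin> Q"
      using prime_s_idealD(4)[OF Q(1) pow_closed[OF p_closed] val_closed[OF aH]] by simp
    moreover have "(z \<otimes> p) [^] val a \<otimes> a \<in> Q"
      by (rule s_ideal_mult_closed'[OF QI a]) simp
    ultimately show False using val_expansion[OF aH] by simp
  qed
  have "x \<in> Q" if x: "x \<in> P" for x
  proof (rule ccontr)
    assume xQ: "x \<notin> Q"
    have xH: "x \<in> H" using x P_subset by blast
    have "z \<otimes> p \<notin> Q" using zp_notin Q(3) by blast
    then have "x \<otimes> (z \<otimes> p) \<notin> Q" using prime_s_idealD(4)[OF Q(1) xH zp_closed xQ] by simp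
    moreover have "p \<otimes> (z \<otimes> x) \<in> Q" by (rule s_ideal_mult_closed[OF QI pQ z_mult[OF x]])
    moreover have "p \<otimes> (z \<otimes> x) = x \<otimes> (z \<otimes> p)" using xH by (simp add: m_ac)
    ultimately show False by simp
  qed
  then show "Q = P" using Q(3) by blast
qed (use prime p_mem in auto)

text \<open>Extends the valuation to ideals; on a divisorial ideal it turns out to be the exponent
  of \<open>P\<close>.\<close>

definition inf_val :: "'a set \<Rightarrow> nat" where
  "inf_val A = Inf (val ` A)"

lemma le_inf_val_iff: "A \<noteq> {} \<Longrightarrow> n \<le> inf_val A \<longleftrightarrow> (\<forall>x\<in>A. n \<le> val x)"
  unfolding inf_val_def by (rule le_cINF_iff) auto

lemma inf_val_le: "x \<in> A \<Longrightarrow> inf_val A \<le> val x"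
  using le_inf_val_iff[of A "inf_val A"] by blast

lemma inf_val_attained:
  assumes "A \<noteq> {}"
  obtains x where "x \<in> A" "inf_val A = val x"
  using Inf_nat_def1[of "val ` A"] assms by (auto simp: inf_val_def)

lemma inf_val_eqI: "x \<in> A \<Longrightarrow> (\<And>y. y \<in> A \<Longrightarrow> val x \<le> val y) \<Longrightarrow> inf_val A = val x"
  using le_inf_val_iff[of A "val x"] inf_val_le[of x A] by force

text \<open>The bound \<open>n \<le> inf_val B\<close> says exactly that \<open>z [^] n\<close> lies
  in the inverse of \<open>B\<close>, and a set and its closure have the same inverse.\<close>

lemma inf_val_v_closure:
  assumes "A \<subseteq> H" "A \<noteq> {}"
  shows "inf_val (v_closure G H A) = inf_val A"
proof -
  have AK: "A \<subseteq> quotient_group G H" using assms mem_quotient_group by blast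
  have ne: "v_closure G H A \<noteq> {}" using subset_v_closure[OF AK] assms by blast
  have *: "n \<le> inf_val B \<longleftrightarrow> z [^] n \<in> v_inverse G H B" if "B \<subseteq> H" "B \<noteq> {}" for B n
    using that by (auto simp: le_inf_val_iff v_inverse_iff pow_mult_mem_iff subset_iff)
  have "n \<le> inf_val (v_closure G H A) \<longleftrightarrow> n \<le> inf_val A" for n
    using *[OF assms] *[OF v_closure_subset[OF assms(1)] ne] v_inverse_v_closure[OF AK] by simp
  then show ?thesis by (meson antisym order_refl)
qed

lemma inf_val_set_mult:
  assumes A: "A \<subseteq> H" "A \<noteq> {}" and B: "B \<subseteq> H" "B \<noteq> {}"
  shows "inf_val (A <#> B) = inf_val A + inf_val B"
proof -
  obtain a where a: "a \<in> A" "inf_val A = val a" using A by (elim inf_val_attained)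
  obtain b where b: "b \<in> B" "inf_val B = val b" using B by (elim inf_val_attained)
  have v: "val (x \<otimes> y) = val x + val y" if "x \<in> A" "y \<in> B" for x y
    using that A B by (intro val_mult) auto
  have "inf_val (A <#> B) = val (a \<otimes> b)"
  proof (rule inf_val_eqI)
    show "a \<otimes> b \<in> A <#> B" using a b by (auto simp: set_mult_def)
    fix y assume "y \<in> A <#> B"
    then obtain a' b' where y: "y = a' \<otimes> b'" "a' \<in> A" "b' \<in> B" by (auto simp: set_mult_def)
    have "val a \<le> val a'" "val b \<le> val b'" using inf_val_le y a b by metis+
    then show "val (a \<otimes> b) \<le> val y" using v a b y by simp
  qed
  then show ?thesis using v a b by simp
qed

lemma inf_val_H: "inf_val H = 0"
proof -
  have "val \<one> = 0" using val_eq_0_iff[of \<one>] prime_s_idealD(3)[OF prime] by simp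
  then show ?thesis using inf_val_le[of \<one> H] by simp
qed

lemma inf_val_pow:
  assumes "s_ideal G H Q" "Q \<noteq> {}"
  shows "Q [^]\<^bsub>s_ideal_monoid G H\<^esub> (n::nat) \<noteq> {} \<and>
    inf_val (Q [^]\<^bsub>s_ideal_monoid G H\<^esub> n) = n * inf_val Q"
proof (induction n)
  case 0
  show ?case using one_closed inf_val_H by (auto simp del: one_closed)
next
  case (Suc n)
  have "Q [^]\<^bsub>s_ideal_monoid G H\<^esub> n <#> Q \<noteq> {}" using Suc assms(2) by (auto simp: set_mult_def)
  moreover have "inf_val (Q [^]\<^bsub>s_ideal_monoid G H\<^esub> n <#> Q) = inf_val (Q [^]\<^bsub>s_ideal_monoid G H\<^esub> n) + inf_val Q"
    using assms s_ideal_pow[OF assms(1), of n] Suc by (intro inf_val_set_mult) (auto simp: s_ideal_iff)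
  ultimately show ?case using Suc by simp
qed

lemma inf_val_v_product:
  assumes "finite A" "A \<subseteq> {Q. s_ideal G H Q \<and> Q \<noteq> {}}"
  shows "v_product e A \<noteq> {} \<and> inf_val (v_product e A) = (\<Sum>Q\<in>A. e Q * inf_val Q)"
  using assms
proof (induction A)
  case empty
  show ?case using one_closed inf_val_H by (auto simp del: one_closed)
next
  case (insert Q B)
  let ?Q = "Q [^]\<^bsub>s_ideal_monoid G H\<^esub> e Q"
  have Q: "s_ideal G H Q" "Q \<noteq> {}" and B: "B \<subseteq> {Q. s_ideal G H Q}"
    using insert.prems by auto
  have eq: "v_product e (insert Q B) = ?Q <#> v_product e B"
    by (rule v_product_insert[OF insert.hyps(1) B Q(1) insert.hyps(2)])
  have IH: "v_product e B \<noteq> {}" "inf_val (v_product e B) = (\<Sum>Q\<in>B. e Q * inf_val Q)"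
    using insert by auto
  have Qe: "?Q \<noteq> {}" "inf_val ?Q = e Q * inf_val Q" using inf_val_pow[OF Q] by auto
  have "?Q <#> v_product e B \<noteq> {}" using IH Qe by (auto simp: set_mult_def)
  moreover have "inf_val (?Q <#> v_product e B) = inf_val ?Q + inf_val (v_product e B)"
    using s_ideal_pow[OF Q(1), of "e Q"] v_product_s_ideal[OF B, of e] Qe(1) IH(1)
    by (intro inf_val_set_mult) (simp_all add: s_ideal_iff)
  ultimately show ?case using eq insert.hyps Qe(2) IH(2) by simp
qed

lemma inf_val_P: "inf_val P = 1"
proof -
  have "inf_val P = val p"
  proof (rule inf_val_eqI[OF p_mem])
    fix y assume "y \<in> P"
    then have "val y \<noteq> 0" using val_eq_0_iff[of y] P_subset by blast
    then show "val p \<le> val y" by (simp add: val_p)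
  qed
  then show ?thesis by (simp add: val_p)
qed

text \<open>As \<open>P\<close> is minimal, \<open>Q\<close> is not contained in \<open>P\<close>,
  and an element of \<open>Q\<close> outside \<open>P\<close> has valuation 0.\<close>

lemma inf_val_height_one:
  assumes "Q \<in> height_one_primes G H" "Q \<noteq> P"
  shows "inf_val Q = 0"
proof -
  have Q: "prime_s_ideal G H Q" "Q \<noteq> {}" using assms(1) by (auto simp: height_one_primes_def)
  have "\<not> Q \<subseteq> P" using height_one assms(2) Q by (auto simp: height_one_primes_def)
  then obtain x where x: "x \<in> Q" "x \<notin> P" by blast
  then have "val x = 0" using val_eq_0_iff[of x] prime_s_idealD(2)[OF Q(1)] by blast
  then show ?thesis using inf_val_le[OF x(1)] by simp
qed

text \<open>Evaluating \<open>inf_val\<close> on the product turns it into a sum in which only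
  \<open>P\<close> can contribute, with weight 1.\<close>

lemma v_factorization_exponent:
  assumes "v_factorization G H I e"
  shows "e P = inf_val I"
proof -
  let ?A = "{Q. e Q \<noteq> 0}"
  have A: "finite ?A" "?A \<subseteq> height_one_primes G H" "I = v_closure G H (v_product e ?A)"
    using assms by (auto simp: v_factorization_def)
  have A': "?A \<subseteq> {Q. s_ideal G H Q \<and> Q \<noteq> {}}"
    using A(2) by (auto simp: height_one_primes_def prime_s_ideal_def)
  have "v_product e ?A \<subseteq> H" using v_product_s_ideal[of ?A e] A' by (auto simp: s_ideal_iff)
  then have "inf_val I = inf_val (v_product e ?A)"
    unfolding A(3) using inf_val_v_product[OF A(1) A', of e] by (intro inf_val_v_closure) auto
  also have "\<dots> = (\<Sum>Q\<in>?A. e Q * inf_val Q)" using inf_val_v_product[OF A(1) A'] by blast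
  also have "\<dots> = (\<Sum>Q\<in>?A. if Q = P then e P else 0)"
  proof (rule sum.cong)
    fix Q assume "Q \<in> ?A"
    then show "e Q * inf_val Q = (if Q = P then e P else 0)"
      using inf_val_height_one[of Q] subsetD[OF A(2), of Q] inf_val_P by (cases "Q = P") simp_all
  qed simp
  \<comment> \<open>If \<open>P\<close> is outside the support, both sides are 0.\<close>
  also have "\<dots> = e P" using A(1) by (simp add: sum.delta)
  finally show ?thesis by simp
qed

end

section \<open>Height-one primes as maximal divisorial ideals, and uniqueness of exponents\<close>

context krull
begin

lemma v_max_krull_prime:
  assumes "v_max M"
  obtains z p where "krull_prime G H M z p"
proof -
  obtain z p where "p \<in> M" "z \<in> v_inverse G H M" "z \<otimes> p \<notin> M"
    using v_max_uniformizer[OF assms] .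
  then have "krull_prime G H M z p"
    using v_max_prime[OF assms] by unfold_locales
  then show thesis by (rule that)
qed

lemma v_max_height_one: "v_max M \<Longrightarrow> M \<in> height_one_primes G H"
  by (elim v_max_krull_prime krull_prime.height_one)

lemma v_factorization_exists:
  assumes "divisorial_ideal G H I" "I \<noteq> {}"
  shows "\<exists>e. v_factorization G H I e"
proof -
  obtain e where e: "finite {Q. e Q \<noteq> 0}" "{Q. e Q \<noteq> 0} \<subseteq> Collect v_max"
    "I = v_closure G H (v_product e {Q. e Q \<noteq> 0})"
    using v_max_factorization[OF assms] by blast
  then have "v_factorization G H I e"
    unfolding v_factorization_def using v_max_height_one by blast
  then show ?thesis by blast
qed

text \<open>\<open>inv a\<close> lies in the inverse of \<open>{a}\<close>, so the closure of
  \<open>{a}\<close> is contained in the principal ideal of \<open>a\<close>.\<close>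

lemma v_closure_singleton:
  assumes "a \<in> H" "x \<in> v_closure G H {a}"
  shows "x \<otimes> inv a \<in> H"
proof -
  have "inv a \<in> v_inverse G H {a}" using assms by (simp add: v_inverse_iff)
  then show ?thesis using assms by (simp add: v_closure_iff)
qed

text \<open>For \<open>a\<close> in \<open>P\<close>, a product of maximal divisorial ideals lies in
  the principal ideal of \<open>a\<close>, hence in \<open>P\<close>. One factor therefore lies in
  \<open>P\<close>, and it equals \<open>P\<close> by minimality.\<close>

lemma height_one_v_max:
  assumes "P \<in> height_one_primes G H"
  shows "v_max P"
proof -
  have P: "prime_s_ideal G H P" "P \<noteq> {}"
    and min: "\<And>Q. prime_s_ideal G H Q \<Longrightarrow> Q \<noteq> {} \<Longrightarrow> Q \<subseteq> P \<Longrightarrow> Q = P"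
    using assms by (auto simp: height_one_primes_def)
  note PI = prime_s_idealD(1)[OF P(1)]
  obtain a where a: "a \<in> P" using P(2) by blast
  then have aH: "a \<in> H" using prime_s_idealD(2)[OF P(1)] by blast
  have aK: "{a} \<subseteq> quotient_group G H" using aH by simp
  let ?I = "v_closure G H {a}"
  have "divisorial_ideal G H ?I" using aH by (intro divisorial_v_closure) simp
  moreover have "?I \<noteq> {}" using subset_v_closure[OF aK] by blast
  ultimately obtain e where e: "finite {Q. e Q \<noteq> 0}" "{Q. e Q \<noteq> 0} \<subseteq> Collect v_max"
    "?I = v_closure G H (v_product e {Q. e Q \<noteq> 0})"
    using v_max_factorization[of ?I] by blast
  have sI: "{Q. e Q \<noteq> 0} \<subseteq> {Q. s_ideal G H Q}" using e(2) v_max_s_ideal by blast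
  have "v_product e {Q. e Q \<noteq> 0} \<subseteq> quotient_group G H"
    using v_product_s_ideal[OF sI, of e] by (auto simp: s_ideal_iff)
  then have "v_product e {Q. e Q \<noteq> 0} \<subseteq> ?I" unfolding e(3) by (rule subset_v_closure)
  also have "?I \<subseteq> P"
  proof
    fix x assume x: "x \<in> ?I"
    then have xK: "x \<in> quotient_group G H" by (simp add: v_closure_iff)
    have "x \<otimes> inv a \<in> H" using v_closure_singleton[OF aH x] .
    then have "a \<otimes> (x \<otimes> inv a) \<in> P" by (rule s_ideal_mult_closed[OF PI a])
    moreover have "a \<otimes> (x \<otimes> inv a) = x"
      using aH xK by (simp add: m_lcomm[of a x])
    ultimately show "x \<in> P" by simp
  qed
  finally have "v_product e {Q. e Q \<noteq> 0} \<inter> (H - P) = {}" by blast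
  then obtain Q where Q: "e Q \<noteq> 0" "Q \<inter> (H - P) = {}"
    using v_product_disjoint_submonoid[OF _ _ e(1) sI, of "H - P" e] P(1)
    by (auto simp: prime_s_ideal_def)
  then have "v_max Q" using e(2) by blast
  moreover from this have "Q = P"
    using min[OF v_max_prime[of Q]] Q(2) divisorial_idealD(1)[of Q] by (auto simp: v_max_def)
  ultimately show ?thesis by simp
qed

lemma height_one_krull_prime:
  assumes "P \<in> height_one_primes G H"
  obtains z p where "krull_prime G H P z p"
  using v_max_krull_prime[OF height_one_v_max[OF assms]] .

text \<open>At height-one primes \<open>inf_val\<close> determines the exponent; elsewhere
  \<open>v_factorization\<close> makes it 0.\<close>

lemma v_factorization_unique:
  assumes "v_factorization G H I e" "v_factorization G H I e'"
  shows "e = e'"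
proof
  fix Q
  show "e Q = e' Q"
  proof (cases "Q \<in> height_one_primes G H")
    case True
    then obtain z p where "krull_prime G H Q z p" by (rule height_one_krull_prime)
    then show ?thesis using krull_prime.v_factorization_exponent assms by metis
  next
    case False
    then have "e Q = 0" "e' Q = 0" using assms unfolding v_factorization_def by blast+
    then show ?thesis by simp
  qed
qed

end

lemma (in krull_prime) v_val_eq:
  assumes "divisorial_ideal G H I" "I \<noteq> {}"
  shows "v_val G H P I = inf_val I"
proof -
  obtain e where e: "v_factorization G H I e" using v_factorization_exists[OF assms] by blast
  then have "(THE e. v_factorization G H I e) = e"
    using v_factorization_unique by blast
  then show ?thesis unfolding v_val_def using v_factorization_exponent[OF e] by simp
qed

section \<open>Saturated submonoids of Krull monoids\<close>

locale saturated_in_krull = T: krull G T for G (structure) and T +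
  fixes H
  assumes saturated: "saturated_submonoid G T H"

sublocale saturated_in_krull \<subseteq> H: comm_group_submonoid G H
  using saturated
  by (intro comm_group_submonoid.intro T.comm_group_axioms) (simp add: saturated_submonoid_def)

context saturated_in_krull
begin

lemma H_subset_T: "H \<subseteq> T"
  using saturated by (simp add: saturated_submonoid_def)

lemma quotient_group_mono: "quotient_group G H \<subseteq> quotient_group G T"
  using H_subset_T unfolding quotient_group_def by blast

text \<open>Saturation in the form used below: a fraction \<open>a \<otimes> inv b\<close> in
  \<open>T\<close> means that \<open>b\<close> divides \<open>a\<close> in \<open>T\<close>, hence
  in \<open>H\<close>, and cancellation identifies the quotient.\<close>

lemma mem_H_if_mem_T:
  assumes "x \<in> T" "x \<in> quotient_group G H"
  shows "x \<in> H"
proof -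
  obtain a b where ab: "x = a \<otimes> inv b" "a \<in> H" "b \<in> H"
    using assms(2) by (auto simp: quotient_group_def)
  then have a: "a = b \<otimes> x" by (simp add: T.m_lcomm[of b a])
  then have "b divides\<^bsub>G\<lparr>carrier := T\<rparr>\<^esub> a" using assms(1) by (auto simp: factor_def)
  then have "b divides\<^bsub>G\<lparr>carrier := H\<rparr>\<^esub> a" using saturated ab by (simp add: saturated_submonoid_def)
  then obtain c where c: "c \<in> H" "a = b \<otimes> c" by (auto simp: factor_def)
  then have "b \<otimes> c = b \<otimes> x" using a by simp
  then have "c = x" using c ab assms by simp
  with c show ?thesis by simp
qed

text \<open>Inverses over \<open>H\<close> are also inverses over \<open>T\<close>, so the products
  land in \<open>T\<close>, and \<open>mem_H_if_mem_T\<close> brings them back to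
  \<open>H\<close>.\<close>

lemma v_closure_T_inter_quotient:
  assumes "I \<subseteq> H"
  shows "v_closure G T I \<inter> quotient_group G H \<subseteq> v_closure G H I"
proof
  fix x assume x: "x \<in> v_closure G T I \<inter> quotient_group G H"
  have "x \<otimes> z \<in> H" if z: "z \<in> v_inverse G H I" for z
  proof (rule mem_H_if_mem_T)
    have "z \<in> v_inverse G T I"
      using z H_subset_T quotient_group_mono by (auto simp: H.v_inverse_iff T.v_inverse_iff)
    then show "x \<otimes> z \<in> T" using x by (auto simp: T.v_closure_iff)
    show "x \<otimes> z \<in> quotient_group G H" using x z by (auto simp: H.v_inverse_iff)
  qed
  with x show "x \<in> v_closure G H I" by (simp add: H.v_closure_iff)
qed

text \<open>\<open>I\<close> can be recovered from its closure over \<open>T\<close>; the ascending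
  chain condition therefore passes from \<open>T\<close> to \<open>H\<close>.\<close>

lemma divisorial_eq_inter:
  assumes "divisorial_ideal G H I"
  shows "I = v_closure G T I \<inter> quotient_group G H"
proof
  have IH: "I \<subseteq> H" by (rule H.divisorial_idealD(1)[OF assms])
  then show "v_closure G T I \<inter> quotient_group G H \<subseteq> I"
    using v_closure_T_inter_quotient[OF IH] H.divisorial_idealD(2)[OF assms] by simp
  have "I \<subseteq> quotient_group G H" using IH by auto
  then show "I \<subseteq> v_closure G T I \<inter> quotient_group G H"
    using T.subset_v_closure[of I] quotient_group_mono by blast
qed

lemma mori: "mori_monoid G H"
  unfolding mori_monoid_def
proof (intro conjI allI impI)
  fix I :: "nat \<Rightarrow> 'a set"
  assume I: "(\<forall>n. divisorial_ideal G H (I n)) \<and> (\<forall>n. I n \<subseteq> I (Suc n))"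
  have "divisorial_ideal G T (v_closure G T (I n))" for n
    using I H.divisorial_idealD(1)[of "I n"] H_subset_T by (intro T.divisorial_v_closure) blast
  moreover have "v_closure G T (I n) \<subseteq> v_closure G T (I (Suc n))" for n
    using I by (intro T.v_closure_mono) blast
  ultimately have "\<exists>N. \<forall>n\<ge>N. v_closure G T (I n) = v_closure G T (I N)"
    using T.krull_monoid unfolding krull_monoid_def mori_monoid_def by simp
  then obtain N where N: "\<And>n. n \<ge> N \<Longrightarrow> v_closure G T (I n) = v_closure G T (I N)" by blast
  have "I n = I N" if "n \<ge> N" for n
    using divisorial_eq_inter[of "I n"] divisorial_eq_inter[of "I N"] I N[OF that] by metis
  then show "\<exists>N. \<forall>n\<ge>N. I n = I N" by blast
qed (rule H.submonoid_axioms)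

lemma completely_integrally_closed_H: "completely_integrally_closed G H"
  unfolding completely_integrally_closed_def
proof (intro ballI impI)
  fix x assume x: "x \<in> quotient_group G H" and "\<exists>c\<in>H. \<forall>n::nat. c \<otimes> x [^] n \<in> H"
  then obtain c where c: "c \<in> H" "\<And>n::nat. c \<otimes> x [^] n \<in> H" by blast
  have "x \<in> T"
    by (rule T.completely_integrally_closedD[of x c]) (use x c quotient_group_mono H_subset_T in blast)+
  then show "x \<in> H" using x by (rule mem_H_if_mem_T)
qed

end

text \<open>The valuation theory becomes available for \<open>H\<close> alongside
  \<open>T\<close>.\<close>

sublocale saturated_in_krull \<subseteq> H: krull G H
  by unfold_locales (simp add: krull_monoid_def mori completely_integrally_closed_H)

section \<open>Height-one primes of \<open>T\<close> over a height-one prime of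
  \<open>H\<close>\<close>

context saturated_in_krull
begin

lemma height_one_over_exists:
  assumes P: "P \<in> height_one_primes G H"
  obtains Q where "Q \<in> height_one_primes G T" "Q \<inter> H = P"
proof -
  have Pprime: "prime_s_ideal G H P" and "P \<noteq> {}"
    and min: "\<And>Q. prime_s_ideal G H Q \<Longrightarrow> Q \<noteq> {} \<Longrightarrow> Q \<subseteq> P \<Longrightarrow> Q = P"
    using P by (auto simp: height_one_primes_def)
  note PH = H.prime_s_idealD(2)[OF Pprime]
  then obtain a where a: "a \<in> P" "a \<in> H" "a \<in> T" using \<open>P \<noteq> {}\<close> H_subset_T by blast
  have aT: "{a} \<subseteq> T" "{a} \<subseteq> quotient_group G T" using a by auto
  let ?I = "v_closure G T {a}"
  have "?I \<noteq> {}" using T.subset_v_closure[OF aT(2)] by blast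
  then obtain e where e: "v_factorization G T ?I e"
    using T.v_factorization_exists[OF T.divisorial_v_closure[OF aT(1)]] by blast
  let ?A = "{Q. e Q \<noteq> 0}"
  have A: "finite ?A" "?A \<subseteq> height_one_primes G T" and I: "?I = v_closure G T (T.v_product e ?A)"
    using e unfolding v_factorization_def by blast+
  have A': "?A \<subseteq> {Q. s_ideal G T Q}"
    using A(2) by (auto simp: height_one_primes_def prime_s_ideal_def)
  have "T.v_product e ?A \<subseteq> quotient_group G T"
    using T.v_product_s_ideal[OF A', of e] by (auto simp: T.s_ideal_iff)
  then have sub: "T.v_product e ?A \<subseteq> ?I" unfolding I by (rule T.subset_v_closure)
  \<comment> \<open>By saturation, a multiple of \<open>a\<close> in \<open>T\<close> that lies in
    \<open>H\<close> is a multiple of \<open>a\<close> in \<open>H\<close>.\<close>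
  have "x \<in> P" if x: "x \<in> ?I" "x \<in> H" for x
  proof -
    have "x \<otimes> inv a \<in> H"
      using T.v_closure_singleton[OF a(3) x(1)] x(2) a(2) by (intro mem_H_if_mem_T) simp_all
    then have "a \<otimes> (x \<otimes> inv a) \<in> P"
      by (rule H.s_ideal_mult_closed[OF H.prime_s_idealD(1)[OF Pprime] a(1)])
    then show ?thesis using a x by (simp add: T.m_lcomm[of a x])
  qed
  then have "T.v_product e ?A \<inter> (H - P) = {}" using sub by blast
  then obtain Q where Q: "e Q \<noteq> 0" "Q \<inter> (H - P) = {}"
    using T.v_product_disjoint_submonoid[OF _ _ A(1) A', of "H - P" e] Pprime H_subset_T
    by (auto simp: prime_s_ideal_def)
  have QT: "Q \<in> height_one_primes G T" using A(2) Q(1) by blast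
  then obtain z p where "krull_prime G T Q z p" by (rule T.height_one_krull_prime)
  then interpret Q: krull_prime G T Q z p .
  \<comment> \<open>So far \<open>Q \<inter> H\<close> is only known to lie in \<open>P\<close>. The
    positive exponent puts \<open>a\<close> into \<open>Q\<close>, so the intersection is nonempty
    and minimality of \<open>P\<close> applies.\<close>
  have "e Q = Q.inf_val {a}"
    using Q.v_factorization_exponent[OF e] Q.inf_val_v_closure[OF aT(1)] by simp
  also have "\<dots> = Q.val a" by (rule Q.inf_val_eqI) auto
  finally have aQ: "a \<in> Q" using Q(1) Q.val_eq_0_iff[OF a(3)] by simp
  have "prime_s_ideal G H (Q \<inter> H)"
  proof (rule H.prime_s_idealI)
    show "s_ideal G H (Q \<inter> H)"
      using Q.P_s_ideal H_subset_T by (auto simp: H.s_ideal_iff T.s_ideal_iff)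
    show "\<one> \<notin> Q \<inter> H" using T.prime_s_idealD(3)[OF Q.prime] by blast
    show "x \<otimes> y \<notin> Q \<inter> H" if "x \<in> H" "y \<in> H" "x \<notin> Q \<inter> H" "y \<notin> Q \<inter> H" for x y
      using T.prime_s_idealD(4)[OF Q.prime, of x y] that H_subset_T by auto
  qed
  then have "Q \<inter> H = P" using min[of "Q \<inter> H"] aQ a(2) Q(2) by blast
  with QT show thesis by (rule that)
qed

text \<open>The factor of proportionality is the ramification index of \<open>Q\<close> over
  \<open>P\<close>, computed as the valuation at \<open>Q\<close> of the uniformizer
  \<open>p\<close>.\<close>

lemma v_val_over:
  assumes I: "divisorial_ideal G H I" "I \<noteq> {}"
    and P: "P \<in> height_one_primes G H"
    and Q: "Q \<in> height_one_primes G T" "Q \<inter> H = P"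
  shows "v_val G T Q (v_closure G T P) > 0"
    and "v_val G T Q (v_closure G T I) = v_val G T Q (v_closure G T P) * v_val G H P I"
proof -
  obtain z p where "krull_prime G H P z p" using P by (rule H.height_one_krull_prime)
  then interpret P: krull_prime G H P z p .
  obtain z' p' where "krull_prime G T Q z' p'" using Q(1) by (rule T.height_one_krull_prime)
  then interpret Q: krull_prime G T Q z' p' .
  have eq0: "Q.val x = 0" if "x \<in> H" "x \<notin> P" for x
    using Q.val_eq_0_iff[of x] that Q(2) H_subset_T by blast
  have Qpow: "Q.val (x [^] n) = n * Q.val x" if "x \<in> T" for x and n :: nat
  proof (induction n)
    case 0
    show ?case using Q.val_eq_0_iff[of \<one>] T.prime_s_idealD(3)[OF Q.prime] by simp
  next
    case (Suc n)
    then show ?case using that Q.val_mult[of "x [^] n" x] by simp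
  qed
  have pT: "p \<in> T" using P.p_closed H_subset_T by blast
  \<comment> \<open>Both sides of \<open>P.val_expansion\<close> are evaluated at \<open>Q\<close>;
    the factors outside \<open>P\<close> are outside \<open>Q\<close> as well and contribute
    0.\<close>
  have val: "Q.val x = Q.val p * P.val x" if x: "x \<in> H" for x
  proof -
    let ?n = "P.val x"
    have "Q.val (p [^] ?n \<otimes> (z [^] ?n \<otimes> x)) = Q.val (p [^] ?n) + Q.val (z [^] ?n \<otimes> x)"
      using pT P.val_closed[OF x] H_subset_T by (intro Q.val_mult) auto
    also have "Q.val (z [^] ?n \<otimes> x) = 0" using P.val_closed[OF x] P.val_notin[OF x] by (rule eq0)
    also have "Q.val (p [^] ?n) = ?n * Q.val p" by (rule Qpow[OF pT])
    finally have "?n * Q.val p = Q.val ((z \<otimes> p) [^] ?n \<otimes> x)"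
      using P.val_expansion[OF x] by simp
    also have "\<dots> = Q.val ((z \<otimes> p) [^] ?n) + Q.val x"
      using x P.zp_closed H_subset_T by (intro Q.val_mult) auto
    also have "Q.val ((z \<otimes> p) [^] ?n) = 0"
      using P.zp_pow_notin by (intro eq0) simp_all
    finally show ?thesis by (simp add: mult.commute)
  qed
  \<comment> \<open>An element minimizing the valuation at \<open>P\<close> on \<open>J\<close> also
    minimizes the proportional valuation at \<open>Q\<close>.\<close>
  have key: "v_val G T Q (v_closure G T J) = Q.val p * P.inf_val J" if J: "J \<subseteq> H" "J \<noteq> {}" for J
  proof -
    have JT: "J \<subseteq> T" using J H_subset_T by blast
    then have JK: "J \<subseteq> quotient_group G T" by auto
    have "v_closure G T J \<noteq> {}" using T.subset_v_closure[OF JK] J by blast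
    then have "v_val G T Q (v_closure G T J) = Q.inf_val J"
      using Q.v_val_eq[OF T.divisorial_v_closure[OF JT]] Q.inf_val_v_closure[OF JT J(2)] by simp
    also obtain x where x: "x \<in> J" "P.inf_val J = P.val x" using J(2) by (rule P.inf_val_attained)
    have "Q.inf_val J = Q.val x"
    proof (rule Q.inf_val_eqI[OF x(1)])
      fix y assume y: "y \<in> J"
      then have "P.val x \<le> P.val y" using P.inf_val_le[OF y] x by simp
      then show "Q.val x \<le> Q.val y" using val[of x] val[of y] J x(1) y by (simp add: subset_iff)
    qed
    also have "\<dots> = Q.val p * P.inf_val J" using val[of x] x J by auto
    finally show ?thesis .
  qed
  \<comment> \<open>The case \<open>J = P\<close>, where the minimum at \<open>P\<close> is
    1.\<close>
  have vP: "v_val G T Q (v_closure G T P) = Q.val p"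
    using key[of P] P.P_subset P.p_mem P.inf_val_P by auto
  have "p \<in> Q" using P.p_mem Q(2) by blast
  then show "v_val G T Q (v_closure G T P) > 0" using vP Q.val_eq_0_iff[OF pT] by simp
  show "v_val G T Q (v_closure G T I) = v_val G T Q (v_closure G T P) * v_val G H P I"
    using key[of I] I H.divisorial_idealD(1)[OF I(1)] vP P.v_val_eq[OF I] by simp
qed

end

text \<open>By \<open>v_val_over\<close> each quotient is exactly the exponent of \<open>P\<close>
  in \<open>I\<close>, and \<open>height_one_over_exists\<close> makes the set of quotients a
  singleton. The conclusion also records what gives the division and \<open>Max\<close> their usual
  meaning.\<close>

theorem proposition4p5:
  fixes G :: "('a, 'b) monoid_scheme" and T H I P :: "'a set"
  assumes "comm_group G"
    and "krull_monoid G T"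
    and "saturated_submonoid G T H"
    and "divisorial_ideal G H I" and "I \<noteq> {}"
    and "P \<in> height_one_primes G H"
  shows "let \<Q> = {Q \<in> height_one_primes G T. Q \<inter> H = P};
             S = {\<lceil>real (v_val G T Q (v_closure G T I)) / real (v_val G T Q (v_closure G T P))\<rceil>
                  | Q. Q \<in> \<Q>}
         in (\<forall>Q\<in>\<Q>. v_val G T Q (v_closure G T P) > 0) \<and> finite S \<and> S \<noteq> {} \<and>
            int (v_val G H P I) = Max S"
proof -
  interpret comm_group G by fact
  interpret saturated_in_krull G T H by unfold_locales fact+
  define \<Q> where "\<Q> = {Q \<in> height_one_primes G T. Q \<inter> H = P}"
  have pos: "v_val G T Q (v_closure G T P) > 0"
    and eq: "\<lceil>real (v_val G T Q (v_closure G T I)) / real (v_val G T Q (v_closure G T P))\<rceil>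
      = int (v_val G H P I)" if "Q \<in> \<Q>" for Q
    using v_val_over[OF assms(4-6), of Q] that by (auto simp: \<Q>_def)
  let ?S = "{\<lceil>real (v_val G T Q (v_closure G T I)) / real (v_val G T Q (v_closure G T P))\<rceil>
      | Q. Q \<in> \<Q>}"
  obtain Q where Q: "Q \<in> \<Q>"
    using height_one_over_exists[OF assms(6)] unfolding \<Q>_def by blast
  have "int (v_val G H P I) \<in> ?S" using eq[OF Q, symmetric] Q by blast
  moreover have "?S \<subseteq> {int (v_val G H P I)}"
  proof
    fix s assume "s \<in> ?S"
    then show "s \<in> {int (v_val G H P I)}" using eq by (elim CollectE exE conjE) simp
  qed
  ultimately have "?S = {int (v_val G H P I)}" by blast
  then show ?thesis unfolding Let_def \<Q>_def[symmetric] using pos by simp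
qed

end
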